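(* Let $q\in(0,1)$ and let $J_q(\,\cdot\,)=J_q(\,\cdot\,;a_{(J)},b)$ be any one of the three $q$-integrals $G_q(\,\cdot\,;bq^n,b)$, $I_q(\,\cdot\,;0,b)$, $R_q(\,\cdot\,;a,b)$ described in the context, with interval of integration $E_{(J)}=[a_{(J)},b]$. Let $f,g:E_{(J)}\to\mathbb{R}$ be two real functions and let $\alpha,\beta>1$ be numbers satisfying $\frac1\alpha+\frac1\beta=1$. Assume that all $q$-integrals appearing below exist. Then the following inequalities hold: (i) $\displaystyle \frac1\alpha J_q(|f|^\alpha)+\frac1\beta J_q(|g|^\beta)\ge\frac{1}{b-a_{(J)}}J_q(|f|)\,J_q(|g|),$ (ii) $\displaystyle \frac1\alpha J_q(|f|^\alpha)J_q(|g|^\alpha)+\frac1\beta J_q(|f|^\beta)J_q(|g|^\beta)\ge\bigl(J_q(|fg|)\bigr)^2,$ (iii) $\displaystyle \frac1\alpha J_q(|f|^\alpha)J_q(|g|^\beta)+\frac1\beta J_q(|f|^\beta)J_q(|g|^\alpha)\ge J_q(|f||g|^{\alpha-1})\,J_q(|f||g|^{\beta-1}),$ (iv) $\displaystyle J_q(|f|^\alpha)\,J_q(|g|^\beta)\ge J_q(|fg|)\,J_q(|f|^{\alpha-1}|g|^{\beta-1}).$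
   Context: Let $q\in(0,1)$. The three types of $q$-integral are: (G) restricted $q$-integral: for $b>0$, a positive integer $n$ and $a=bq^n$, $G_q(h;a,b)=b(1-q)\sum_{k=0}^{n-1}h(bq^k)q^k$; here $a_{(J)}=bq^n$. (I) for $b>0$, $I_q(h;0,b)=b(1-q)\sum_{k=0}^{\infty}h(bq^k)q^k$; here $a_{(J)}=0$. (R) Riemann-type $q$-integral: for $0<a<b$, $R_q(h;a,b)=(b-a)(1-q)\sum_{k=0}^{\infty}h\bigl(a+(b-a)q^k\bigr)q^k$; here $a_{(J)}=a$. In each case $E_{(J)}=[a_{(J)},b]$. A $q$-integral of type (I) or (R) is said to exist if the defining series converges (type (G) always exists). *)

theory Defs
  imports Complex_Main
begin

definition restricted_qint :: "real \<Rightarrow> (real \<Rightarrow> real) \<Rightarrow> real \<Rightarrow> nat \<Rightarrow> real" where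
  "restricted_qint q h b n = b * (1 - q) * (\<Sum>k<n. h (b * q ^ k) * q ^ k)"

definition jackson_qint :: "real \<Rightarrow> (real \<Rightarrow> real) \<Rightarrow> real \<Rightarrow> real" where
  "jackson_qint q h b = b * (1 - q) * (\<Sum>k. h (b * q ^ k) * q ^ k)"

definition riemann_qint :: "real \<Rightarrow> (real \<Rightarrow> real) \<Rightarrow> real \<Rightarrow> real \<Rightarrow> real" where
  "riemann_qint q h a b = (b - a) * (1 - q) * (\<Sum>k. h (a + (b - a) * q ^ k) * q ^ k)"

text \<open>The kind of a $q$-integral together with its parameters: \<open>TypeG b n\<close> is the restricted
  integral from \<open>b * q ^ n\<close> to \<open>b\<close>, \<open>TypeI b\<close> the Jackson integral from \<open>0\<close> to \<open>b\<close>, and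
  \<open>TypeR a b\<close> the Riemann-type integral from \<open>a\<close> to \<open>b\<close>.\<close>

datatype qint_type = TypeG real nat | TypeI real | TypeR real real

fun admissible :: "qint_type \<Rightarrow> bool" where
  "admissible (TypeG b n) \<longleftrightarrow> 0 < b \<and> 0 < n"
| "admissible (TypeI b) \<longleftrightarrow> 0 < b"
| "admissible (TypeR a b) \<longleftrightarrow> 0 < a \<and> a < b"

fun lower_end :: "real \<Rightarrow> qint_type \<Rightarrow> real" where
  "lower_end q (TypeG b n) = b * q ^ n"
| "lower_end q (TypeI b) = 0"
| "lower_end q (TypeR a b) = a"

fun upper_end :: "qint_type \<Rightarrow> real" where
  "upper_end (TypeG b n) = b"
| "upper_end (TypeI b) = b"
| "upper_end (TypeR a b) = b"

fun qint :: "real \<Rightarrow> qint_type \<Rightarrow> (real \<Rightarrow> real) \<Rightarrow> real" where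
  "qint q (TypeG b n) h = restricted_qint q h b n"
| "qint q (TypeI b) h = jackson_qint q h b"
| "qint q (TypeR a b) h = riemann_qint q h a b"

fun qint_exists :: "real \<Rightarrow> qint_type \<Rightarrow> (real \<Rightarrow> real) \<Rightarrow> bool" where
  "qint_exists q (TypeG b n) h \<longleftrightarrow> True"
| "qint_exists q (TypeI b) h \<longleftrightarrow> summable (\<lambda>k. h (b * q ^ k) * q ^ k)"
| "qint_exists q (TypeR a b) h \<longleftrightarrow> summable (\<lambda>k. h (a + (b - a) * q ^ k) * q ^ k)"

text \<open>Integrands are total functions on the reals, but only their values on the interval of
  integration matter; so total functions faithfully represent functions on that interval.\<close>

lemma qint_cong_on_interval:
  assumes q: "0 < q" "q < 1" and J: "admissible J"
    and eq: "\<And>x. x \<in> {lower_end q J..upper_end J} \<Longrightarrow> h x = h' x"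
  shows "qint q J h = qint q J h'" and "qint_exists q J h \<longleftrightarrow> qint_exists q J h'"
proof -
  have le1: "q ^ k \<le> 1" for k
    using q by (simp add: power_le_one)
  have "qint q J h = qint q J h' \<and> (qint_exists q J h \<longleftrightarrow> qint_exists q J h')"
  proof (cases J)
    case (TypeG b n)
    have "h (b * q ^ k) = h' (b * q ^ k)" if "k < n" for k
      using that q J le1[of k] power_decreasing[of k n q]
      by (intro eq) (auto simp: TypeG mult_left_le)
    then show ?thesis by (simp add: TypeG restricted_qint_def)
  next
    case (TypeI b)
    have "h (b * q ^ k) = h' (b * q ^ k)" for k
      using q J le1[of k] by (intro eq) (auto simp: TypeI mult_left_le)
    then show ?thesis by (simp add: TypeI jackson_qint_def)
  next
    case (TypeR a b)
    have "h (a + (b - a) * q ^ k) = h' (a + (b - a) * q ^ k)" for k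
    proof (rule eq)
      have "0 \<le> b - a" using J by (simp add: TypeR)
      then have "0 \<le> (b - a) * q ^ k" and "(b - a) * q ^ k \<le> b - a"
        using q le1[of k] by (simp, intro mult_left_le)
      then show "a + (b - a) * q ^ k \<in> {lower_end q J..upper_end J}"
        unfolding TypeR lower_end.simps upper_end.simps atLeastAtMost_iff by linarith
    qed
    then show ?thesis by (simp add: TypeR riemann_qint_def)
  qed
  then show "qint q J h = qint q J h'" and "qint_exists q J h \<longleftrightarrow> qint_exists q J h'"
    by auto
qed

end

theory Submission
  imports Defs "HOL-Analysis.Convex"
begin

text \<open>A $q$-integral is a positive linear functional: it integrates against nonnegative weights
  at countably many nodes, of total mass \<open>upper_end J - lower_end q J\<close>. Hence an inequality
  \<open>C x * D y \<le> c * (A x * B y) + d * (A' x * B' y)\<close> valid for all \<open>x\<close> and \<open>y\<close> may be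
  integrated in \<open>x\<close> and then in \<open>y\<close> (\<open>qint_product_le\<close>), and no double series has to be
  handled. Each of the four claims is such an integrated Young inequality
  $uv \le u^\alpha/\alpha + v^\beta/\beta$. With $f$ and $g$ nonnegative, the choices of $(u,v)$
  are, in turn, $(f(x), g(y))$, $(f(x)g(y), f(y)g(x))$,
  $(f(x)g(y)^{\beta-1}, f(y)g(x)^{\alpha-1})$ and $(f(x)g(y)^{\beta-1}, f(y)^{\alpha-1}g(x))$;
  the powers are computed from $\alpha(\beta-1) = \beta$ and $\beta(\alpha-1) = \alpha$.
  The total mass enters the first claim as the integral of the constant \<open>1\<close>; in the last claim
  both terms on the right integrate to the same product, and
  $1/\alpha + 1/\beta = 1$ merges them.\<close>

lemma suminf_le_lincomb:
  fixes u v w :: "nat \<Rightarrow> real"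
  assumes "summable u" and "summable v" and "summable w"
    and "\<And>k. e * w k \<le> c * u k + d * v k"
  shows "e * suminf w \<le> c * suminf u + d * suminf v"
proof -
  have "e * suminf w = (\<Sum>k. e * w k)"
    using assms by (simp add: suminf_mult)
  also have "\<dots> \<le> (\<Sum>k. c * u k + d * v k)"
    using assms by (intro suminf_le summable_add summable_mult) auto
  also have "\<dots> = c * suminf u + d * suminf v"
    using assms by (simp add: suminf_add[symmetric] suminf_mult summable_mult)
  finally show ?thesis .
qed

text \<open>Linearity and monotonicity in one rule; the coefficients \<open>c\<close>, \<open>d\<close>, \<open>e\<close> may have any
  sign.\<close>

lemma qint_le_lincomb:
  assumes q: "0 < q" "q < 1" and J: "admissible J"
    and ex: "qint_exists q J u" "qint_exists q J v" "qint_exists q J w"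
    and le: "\<And>x. e * w x \<le> c * u x + d * v x"
  shows "e * qint q J w \<le> c * qint q J u + d * qint q J v"
proof -
  have term_le: "e * (w x * q ^ k) \<le> c * (u x * q ^ k) + d * (v x * q ^ k)" for x k
    using mult_right_mono[OF le[of x], of "q ^ k"] q by (simp add: algebra_simps)
  have scale: "e * (m * W) \<le> c * (m * U) + d * (m * V)"
    if "0 \<le> m" and "e * W \<le> c * U + d * V" for m U V W :: real
    using mult_left_mono[OF that(2) that(1)] by (simp add: algebra_simps)
  show ?thesis
  proof (cases J)
    case (TypeG b n)
    have "e * (\<Sum>k<n. w (b * q ^ k) * q ^ k)
        \<le> c * (\<Sum>k<n. u (b * q ^ k) * q ^ k) + d * (\<Sum>k<n. v (b * q ^ k) * q ^ k)"
      unfolding sum_distrib_left sum.distrib[symmetric] by (intro sum_mono term_le)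
    then show ?thesis
      using q J by (auto simp: TypeG restricted_qint_def intro!: scale)
  next
    case (TypeI b)
    have "e * (\<Sum>k. w (b * q ^ k) * q ^ k)
        \<le> c * (\<Sum>k. u (b * q ^ k) * q ^ k) + d * (\<Sum>k. v (b * q ^ k) * q ^ k)"
      using ex by (intro suminf_le_lincomb term_le) (auto simp: TypeI)
    then show ?thesis
      using q J by (auto simp: TypeI jackson_qint_def intro!: scale)
  next
    case (TypeR a b)
    have "e * (\<Sum>k. w (a + (b - a) * q ^ k) * q ^ k)
        \<le> c * (\<Sum>k. u (a + (b - a) * q ^ k) * q ^ k)
          + d * (\<Sum>k. v (a + (b - a) * q ^ k) * q ^ k)"
      using ex by (intro suminf_le_lincomb term_le) (auto simp: TypeR)
    then show ?thesis
      using q J by (auto simp: TypeR riemann_qint_def intro!: scale)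
  qed
qed

lemma qint_one:
  assumes "0 < q" "q < 1"
  shows "qint_exists q J (\<lambda>x. 1)" and "qint q J (\<lambda>x. 1) = upper_end J - lower_end q J"
proof -
  have geo: "(\<Sum>k. q ^ k) = 1 / (1 - q)" "summable (\<lambda>k. q ^ k)"
    using assms by (auto intro: suminf_geometric summable_geometric)
  have fin: "(1 - q) * (\<Sum>k<n. q ^ k) = 1 - q ^ n" for n
    by (simp add: one_diff_power_eq)
  show "qint_exists q J (\<lambda>x. 1)"
    using geo by (cases J) auto
  show "qint q J (\<lambda>x. 1) = upper_end J - lower_end q J"
  proof (cases J)
    case (TypeG b n)
    have "qint q J (\<lambda>x. 1) = b * ((1 - q) * (\<Sum>k<n. q ^ k))"
      by (simp add: TypeG restricted_qint_def)
    then show ?thesis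
      unfolding fin by (simp add: TypeG right_diff_distrib)
  qed (use geo assms in \<open>simp_all add: jackson_qint_def riemann_qint_def\<close>)
qed

lemma qint_product_le:
  assumes q: "0 < q" "q < 1" and J: "admissible J"
    and ex: "qint_exists q J A" "qint_exists q J A'" "qint_exists q J C"
      "qint_exists q J B" "qint_exists q J B'" "qint_exists q J D"
    and le: "\<And>x y. C x * D y \<le> c * (A x * B y) + d * (A' x * B' y)"
  shows "qint q J C * qint q J D
    \<le> c * qint q J A * qint q J B + d * qint q J A' * qint q J B'"
proof -
  \<comment> \<open>Integrate in \<open>x\<close> for fixed \<open>y\<close>; the result is again an inequality between
    functions of \<open>y\<close> with constant coefficients, to be integrated in \<open>y\<close>.\<close>
  have inner: "D y * qint q J C \<le> (c * B y) * qint q J A + (d * B' y) * qint q J A'" for y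
  proof (rule qint_le_lincomb[OF q J ex(1-3)])
    show "D y * C x \<le> (c * B y) * A x + (d * B' y) * A' x" for x
      using le[of x y] by (simp add: mult_ac)
  qed
  show ?thesis
  proof (rule qint_le_lincomb[OF q J ex(4-6)])
    show "qint q J C * D y \<le> c * qint q J A * B y + d * qint q J A' * B' y" for y
      using inner[of y] by (simp add: mult_ac)
  qed
qed

theorem theorem6p1:
  fixes q \<alpha> \<beta> :: real and J :: qint_type and f g :: "real \<Rightarrow> real"
  assumes "0 < q" and "q < 1"
    and "admissible J"
    and "\<alpha> > 1" and "\<beta> > 1" and "1 / \<alpha> + 1 / \<beta> = 1"
    and "qint_exists q J (\<lambda>x. \<bar>f x\<bar>)"
    and "qint_exists q J (\<lambda>x. \<bar>g x\<bar>)"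
    and "qint_exists q J (\<lambda>x. \<bar>f x\<bar> powr \<alpha>)"
    and "qint_exists q J (\<lambda>x. \<bar>f x\<bar> powr \<beta>)"
    and "qint_exists q J (\<lambda>x. \<bar>g x\<bar> powr \<alpha>)"
    and "qint_exists q J (\<lambda>x. \<bar>g x\<bar> powr \<beta>)"
    and "qint_exists q J (\<lambda>x. \<bar>f x * g x\<bar>)"
    and "qint_exists q J (\<lambda>x. \<bar>f x\<bar> * \<bar>g x\<bar> powr (\<alpha> - 1))"
    and "qint_exists q J (\<lambda>x. \<bar>f x\<bar> * \<bar>g x\<bar> powr (\<beta> - 1))"
    and "qint_exists q J (\<lambda>x. \<bar>f x\<bar> powr (\<alpha> - 1) * \<bar>g x\<bar> powr (\<beta> - 1))"
  shows
    "1 / \<alpha> * qint q J (\<lambda>x. \<bar>f x\<bar> powr \<alpha>) + 1 / \<beta> * qint q J (\<lambda>x. \<bar>g x\<bar> powr \<beta>)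
        \<ge> 1 / (upper_end J - lower_end q J) * qint q J (\<lambda>x. \<bar>f x\<bar>) * qint q J (\<lambda>x. \<bar>g x\<bar>)
     \<and>
     1 / \<alpha> * qint q J (\<lambda>x. \<bar>f x\<bar> powr \<alpha>) * qint q J (\<lambda>x. \<bar>g x\<bar> powr \<alpha>)
       + 1 / \<beta> * qint q J (\<lambda>x. \<bar>f x\<bar> powr \<beta>) * qint q J (\<lambda>x. \<bar>g x\<bar> powr \<beta>)
        \<ge> (qint q J (\<lambda>x. \<bar>f x * g x\<bar>))\<^sup>2
     \<and>
     1 / \<alpha> * qint q J (\<lambda>x. \<bar>f x\<bar> powr \<alpha>) * qint q J (\<lambda>x. \<bar>g x\<bar> powr \<beta>)
       + 1 / \<beta> * qint q J (\<lambda>x. \<bar>f x\<bar> powr \<beta>) * qint q J (\<lambda>x. \<bar>g x\<bar> powr \<alpha>)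
        \<ge> qint q J (\<lambda>x. \<bar>f x\<bar> * \<bar>g x\<bar> powr (\<alpha> - 1)) * qint q J (\<lambda>x. \<bar>f x\<bar> * \<bar>g x\<bar> powr (\<beta> - 1))
     \<and>
     qint q J (\<lambda>x. \<bar>f x\<bar> powr \<alpha>) * qint q J (\<lambda>x. \<bar>g x\<bar> powr \<beta>)
        \<ge> qint q J (\<lambda>x. \<bar>f x * g x\<bar>) * qint q J (\<lambda>x. \<bar>f x\<bar> powr (\<alpha> - 1) * \<bar>g x\<bar> powr (\<beta> - 1))"
proof -
  note q = assms(1,2) and J = assms(3) and ex = assms(7-16)
  have \<alpha>: "\<alpha> * (\<beta> - 1) = \<beta>" and \<beta>: "\<beta> * (\<alpha> - 1) = \<alpha>"
    using assms(4-6) by (simp_all add: field_simps)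
  have young: "u * v \<le> 1 / \<alpha> * u powr \<alpha> + 1 / \<beta> * v powr \<beta>" if "0 \<le> u" "0 \<le> v" for u v
    using Youngs_inequality[of \<alpha> \<beta> u v] assms(4-6) that by simp
  note powers = powr_mult powr_powr \<alpha> \<beta> mult.commute[of _ \<alpha>] mult.commute[of _ \<beta>]
  let ?J = "qint q J"
  let ?f = "\<lambda>x. \<bar>f x\<bar>" and ?g = "\<lambda>x. \<bar>g x\<bar>"
  let ?fg = "\<lambda>x. \<bar>f x * g x\<bar>"

  have len: "0 < upper_end J - lower_end q J"
  proof (cases J)
    case (TypeG b n)
    then have "q ^ n < 1"
      using q J by (simp add: power_less_one_iff)
    then show ?thesis
      using J by (simp add: TypeG)
  qed (use J in auto)
  have "?J ?f * ?J ?g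
      \<le> 1 / \<alpha> * ?J (\<lambda>x. ?f x powr \<alpha>) * ?J (\<lambda>x. 1)
        + 1 / \<beta> * ?J (\<lambda>x. 1) * ?J (\<lambda>x. ?g x powr \<beta>)"
  proof (intro qint_product_le q J ex qint_one)
    show "?f x * ?g y \<le> 1 / \<alpha> * (?f x powr \<alpha> * 1) + 1 / \<beta> * (1 * ?g y powr \<beta>)" for x y
      using young[of "?f x" "?g y"] by simp
  qed
  also have "\<dots> = (1 / \<alpha> * ?J (\<lambda>x. ?f x powr \<alpha>) + 1 / \<beta> * ?J (\<lambda>x. ?g x powr \<beta>))
      * (upper_end J - lower_end q J)"
    unfolding qint_one(2)[OF q] distrib_right by (simp only: mult_ac)
  finally have i: "1 / (upper_end J - lower_end q J) * ?J ?f * ?J ?g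
      \<le> 1 / \<alpha> * ?J (\<lambda>x. ?f x powr \<alpha>) + 1 / \<beta> * ?J (\<lambda>x. ?g x powr \<beta>)"
    using len by (simp add: pos_divide_le_eq)

  have ii: "?J ?fg * ?J ?fg
      \<le> 1 / \<alpha> * ?J (\<lambda>x. ?f x powr \<alpha>) * ?J (\<lambda>x. ?g x powr \<alpha>)
        + 1 / \<beta> * ?J (\<lambda>x. ?g x powr \<beta>) * ?J (\<lambda>x. ?f x powr \<beta>)"
  proof (intro qint_product_le q J ex)
    show "?fg x * ?fg y \<le> 1 / \<alpha> * (?f x powr \<alpha> * ?g y powr \<alpha>)
        + 1 / \<beta> * (?g x powr \<beta> * ?f y powr \<beta>)" for x y
      using young[of "?f x * ?g y" "?g x * ?f y"]
      by (simp add: powers abs_mult mult_ac)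
  qed

  have iii: "?J (\<lambda>x. ?f x * ?g x powr (\<alpha> - 1)) * ?J (\<lambda>x. ?f x * ?g x powr (\<beta> - 1))
      \<le> 1 / \<alpha> * ?J (\<lambda>x. ?f x powr \<alpha>) * ?J (\<lambda>x. ?g x powr \<beta>)
        + 1 / \<beta> * ?J (\<lambda>x. ?g x powr \<alpha>) * ?J (\<lambda>x. ?f x powr \<beta>)"
  proof (intro qint_product_le q J ex)
    show "?f x * ?g x powr (\<alpha> - 1) * (?f y * ?g y powr (\<beta> - 1))
        \<le> 1 / \<alpha> * (?f x powr \<alpha> * ?g y powr \<beta>)
          + 1 / \<beta> * (?g x powr \<alpha> * ?f y powr \<beta>)" for x y
      using young[of "?f x * ?g y powr (\<beta> - 1)" "?g x powr (\<alpha> - 1) * ?f y"]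
      by (simp add: powers mult_ac)
  qed

  have "?J ?fg * ?J (\<lambda>x. ?f x powr (\<alpha> - 1) * ?g x powr (\<beta> - 1))
      \<le> 1 / \<alpha> * ?J (\<lambda>x. ?f x powr \<alpha>) * ?J (\<lambda>x. ?g x powr \<beta>)
        + 1 / \<beta> * ?J (\<lambda>x. ?g x powr \<beta>) * ?J (\<lambda>x. ?f x powr \<alpha>)"
  proof (intro qint_product_le q J ex)
    show "?fg x * (?f y powr (\<alpha> - 1) * ?g y powr (\<beta> - 1))
        \<le> 1 / \<alpha> * (?f x powr \<alpha> * ?g y powr \<beta>)
          + 1 / \<beta> * (?g x powr \<beta> * ?f y powr \<alpha>)" for x y
      using young[of "?f x * ?g y powr (\<beta> - 1)" "?g x * ?f y powr (\<alpha> - 1)"]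
      by (simp add: powers abs_mult mult_ac)
  qed
  also have "\<dots> = (1 / \<alpha> + 1 / \<beta>) * (?J (\<lambda>x. ?f x powr \<alpha>) * ?J (\<lambda>x. ?g x powr \<beta>))"
    by (simp add: algebra_simps)
  finally have iv: "?J ?fg * ?J (\<lambda>x. ?f x powr (\<alpha> - 1) * ?g x powr (\<beta> - 1))
      \<le> ?J (\<lambda>x. ?f x powr \<alpha>) * ?J (\<lambda>x. ?g x powr \<beta>)"
    using assms(6) by simp

  show ?thesis
    using i ii iii iv by (simp add: power2_eq_square mult_ac)
qed

end
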